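(* Let $R \cong R_1 \times R_2 \times \cdots \times R_n$ with $n \ge 2$ be an Artinian non-local commutative ring with unity, where each $R_i$ is a local ring, and assume $R$ is not isomorphic to a direct product of two fields. Then the prime ideal sum graph $\mathrm{PIS}(R)$ has diameter $2$.
   Context: For a commutative ring $R$ with unity, the prime ideal sum graph $\mathrm{PIS}(R)$ is the simple undirected graph whose vertex set is the set of all nonzero proper ideals of $R$, with two distinct vertices $I$ and $J$ adjacent if and only if $I+J$ is a prime ideal of $R$. The diameter of a connected graph is the maximum distance between two of its vertices. *)

theory Defs
  imports
    "HOL-Algebra.Chinese_Remainder"
    "Graph_Theory.Graph_Theory"
begin

section \<open>Artinian rings and local rings\<close>

locale artinian_cring = cring +
  assumes descending_chain:
    "\<lbrakk>\<And>k. ideal (C k) R; \<And>k. C (Suc k) \<subseteq> C k\<rbrakk> \<Longrightarrow> \<exists>N. \<forall>k\<ge>N. C k = C (N :: nat)"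

text \<open>The zero ring has no maximal ideal, hence is not local.\<close>

locale local_cring = cring +
  assumes unique_maximal: "\<exists>!M. maximalideal M R"

section \<open>Products of two fields\<close>

text \<open>
  To say that \<^term>\<open>R\<close> is, or is not, isomorphic to a product of two fields, it suffices to
  quantify over fields with the element type of \<^term>\<open>R\<close>: fields over other types give
  nothing more.
\<close>

lemma product_of_two_fields_any_type:
  fixes R :: "('a, 'm) ring_scheme"
    and K :: "('c, 'k) ring_scheme" and L :: "('d, 'l) ring_scheme"
  assumes "ring R" "field K" "field L" "R \<simeq> RDirProd K L"
  shows "\<exists>(K' :: 'a ring) (L' :: 'a ring). field K' \<and> field L' \<and> R \<simeq> RDirProd K' L'"
proof -
  interpret K: field K by fact
  interpret L: field L by fact
  obtain h where h: "h \<in> ring_iso R (RDirProd K L)"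
    using assms(4) unfolding is_ring_iso_def by blast
  define g where "g = inv_into (carrier R) h"
  have "bij_betw h (carrier R) (carrier K \<times> carrier L)"
    using ring_iso_memE(5)[OF h] by (simp add: RDirProd_carrier)
  then have inj: "inj_on g (carrier K \<times> carrier L)"
    unfolding g_def by (metis bij_betw_def inj_on_inv_into subset_refl)
  define a where "a = (\<lambda>k. g (k, \<zero>\<^bsub>L\<^esub>))"
  define b where "b = (\<lambda>l. g (\<zero>\<^bsub>K\<^esub>, l))"
  have a: "inj_on a (carrier K)" and b: "inj_on b (carrier L)"
    using inj K.zero_closed L.zero_closed unfolding a_def b_def inj_on_def by blast+
  have "field (image_ring a K)" "field (image_ring b L)"
    using K.inj_imp_image_ring_is_field[OF a] L.inj_imp_image_ring_is_field[OF b] by auto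
  moreover have "R \<simeq> RDirProd (image_ring a K) (image_ring b L)"
    using ring_iso_set_trans[OF h
        RDirProd_iso6[OF inj_imp_image_ring_iso[OF a] inj_imp_image_ring_iso[OF b]]]
    unfolding is_ring_iso_def by blast
  ultimately show ?thesis by blast
qed

section \<open>The prime ideal sum graph\<close>

text \<open>
  An undirected edge is represented by its two orientations, as is usual for graphs in
  Graph_Theory.  The finiteness built into its locale \<^locale>\<open>graph\<close> is not wanted here: even
  an Artinian ring can have infinitely many ideals.
\<close>

definition PIS :: "('a, 'm) ring_scheme \<Rightarrow> 'a set pair_pre_digraph" where
  "PIS R =
    (let V = {I. ideal I R \<and> I \<noteq> {\<zero>\<^bsub>R\<^esub>} \<and> I \<noteq> carrier R} in
     \<lparr> pverts = V,
       parcs = {(I, J). I \<in> V \<and> J \<in> V \<and> I \<noteq> J \<and> primeideal (I <+>\<^bsub>R\<^esub> J) R} \<rparr>)"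

lemma PIS_simple_undirected:
  assumes "ring R"
  shows "pair_bidirected_digraph (PIS R)"
proof -
  interpret ring R by fact
  have comm: "I <+>\<^bsub>R\<^esub> J = J <+>\<^bsub>R\<^esub> I" if "ideal I R" "ideal J R" for I J
    using that by (intro set_add_comm) (auto dest: ideal.Icarr)
  show ?thesis
  proof
    fix e assume e: "e \<in> parcs (PIS R)"
    then show "fst e \<in> pverts (PIS R)" "snd e \<in> pverts (PIS R)" "fst e \<noteq> snd e"
      by (simp_all add: PIS_def Let_def split_beta)
  next
    show "symmetric (with_proj (PIS R))"
      unfolding symmetric_def with_proj_simps
    proof (rule symI)
      fix I J assume "(I, J) \<in> parcs (PIS R)"
      then show "(J, I) \<in> parcs (PIS R)"
        using comm[of I J] by (simp add: PIS_def Let_def eq_commute[of J I])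
    qed
  qed
qed

section \<open>Distance and diameter\<close>

text \<open>
  With all weights equal to one, the cost of a walk is its length.  The diameter is a supremum
  in \<^typ>\<open>ereal\<close>; as distances are natural numbers or infinite, a finite supremum over a nonempty
  vertex set is a maximum.
\<close>

definition graph_distance :: "('v, 'e) pre_digraph \<Rightarrow> 'v \<Rightarrow> 'v \<Rightarrow> ereal" where
  "graph_distance G u v = wf_digraph.\<mu> G (\<lambda>_. 1) u v"

definition graph_diameter :: "('v, 'e) pre_digraph \<Rightarrow> ereal" where
  "graph_diameter G = (SUP u \<in> verts G. SUP v \<in> verts G. graph_distance G u v)"

end

theory Submission
  imports Defs "HOL-Algebra.Ring_Divisibility"
begin

text \<open>
  Let \<open>I\<close> and \<open>J\<close> be distinct vertices.  If \<open>I + J\<close> is proper, it lies in a maximal ideal \<open>M\<close>;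
  then \<open>I + M = M = J + M\<close>, so either one of \<open>I\<close>, \<open>J\<close> equals \<open>M\<close> and they are adjacent, or \<open>M\<close>
  is a common neighbour.  If \<open>I + J = R\<close>, choose maximal ideals \<open>M \<supseteq> I\<close> and \<open>N \<supseteq> J\<close>.  By the
  modular law \<open>I + (M \<inter> N) = M\<close> and \<open>J + (M \<inter> N) = N\<close>, so \<open>M \<inter> N\<close> is a common neighbour,
  provided it is nonzero; were it zero, the Chinese remainder theorem would make \<open>R\<close> the product
  of the fields \<open>R/M\<close> and \<open>R/N\<close>.  Two distinct maximal ideals are comaximal, hence at distance
  exactly two.
\<close>

section \<open>Graphs of diameter two\<close>

text \<open>\<open>connected\<close> refers to the symmetric closure of the graph, and reachability
  passes from a graph to its symmetric closure.\<close>

lemma (in wf_digraph) connected_if_reachable: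
  assumes "verts G \<noteq> {}"
    and "\<And>u v. u \<in> verts G \<Longrightarrow> v \<in> verts G \<Longrightarrow> u \<rightarrow>\<^sup>* v"
  shows "connected G"
  using assms reachable_mk_symmetricI
  unfolding connected_def strongly_connected_def by fastforce

text \<open>The short paths bound all distances by 2. The pair \<open>a\<close>, \<open>b\<close>
  attains this bound, since a walk of length 0 or 1 would make its ends equal or adjacent.\<close>

lemma (in wf_digraph) diameter_eq_2I:
  assumes path: "\<And>u v. u \<in> verts G \<Longrightarrow> v \<in> verts G \<Longrightarrow> u \<noteq> v \<Longrightarrow>
      u \<rightarrow>\<^bsub>G\<^esub> v \<or> (\<exists>w. u \<rightarrow>\<^bsub>G\<^esub> w \<and> w \<rightarrow>\<^bsub>G\<^esub> v)"
    and ab: "a \<in> verts G" "b \<in> verts G" "a \<noteq> b" "\<not> a \<rightarrow>\<^bsub>G\<^esub> b"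
  shows "connected G" "graph_diameter G = 2"
proof -
  show "connected G"
  proof (rule connected_if_reachable)
    fix u v assume uv: "u \<in> verts G" "v \<in> verts G"
    show "u \<rightarrow>\<^sup>* v"
      using path[OF uv] uv reachable_adj_trans adj_reachable_trans reachable_refl by metis
  qed (use ab in blast)
  have le: "graph_distance G u v \<le> 2" if uv: "u \<in> verts G" "v \<in> verts G" for u v
  proof -
    have "\<exists>p. awalk u p v \<and> length p \<le> 2"
    proof (cases "u = v")
      case True
      then have "awalk u [] v" using uv by (simp add: awalk_Nil_iff)
      then show ?thesis by force
    next
      case False
      from path[OF uv False] show ?thesis
      proof (elim disjE exE conjE)
        assume "u \<rightarrow>\<^bsub>G\<^esub> v"
        then obtain e where "arc e (u, v)" by (auto simp: arcs_ends_conv arc_def)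
        then have "awalk u [e] v" by (auto simp: awalk_Cons_iff awalk_Nil_iff arc_def)
        then show ?thesis by force
      next
        fix w assume "u \<rightarrow>\<^bsub>G\<^esub> w" "w \<rightarrow>\<^bsub>G\<^esub> v"
        then obtain e f where "arc e (u, w)" "arc f (w, v)"
          by (auto simp: arcs_ends_conv arc_def)
        then have "awalk u [e, f] v" by (auto simp: awalk_Cons_iff awalk_Nil_iff arc_def)
        then show ?thesis by force
      qed
    qed
    then obtain p where p: "awalk u p v" "length p \<le> 2" by blast
    have "ereal (awalk_cost (\<lambda>_. 1) p) \<le> 2"
      using p(2) by (simp add: awalk_cost_def sum_list_triv)
    then show ?thesis
      using min_cost_le_walk_cost[OF p(1)] order_trans unfolding graph_distance_def by blast
  qed
  have "2 \<le> length p" if "awalk a p b" for p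
  proof (rule ccontr)
    assume "\<not> 2 \<le> length p"
    then consider "p = []" | e where "p = [e]"
      by (cases p; cases "tl p") auto
    then show False
      using that ab by cases (auto simp: awalk_Nil_iff awalk_Cons_iff arcs_ends_conv)
  qed
  \<comment> \<open>The distance is an infimum over all walks, so a bound on each of their lengths
    carries over.\<close>
  then have "2 \<le> graph_distance G a b"
    unfolding graph_distance_def \<mu>_def
    by (intro INF_greatest) (auto simp: awalk_cost_def sum_list_triv)
  then show "graph_diameter G = 2"
    unfolding graph_diameter_def
    by (intro antisym SUP_least le SUP_upper2[OF ab(1)] SUP_upper2[OF ab(2)])
qed

section \<open>Sums of ideals and maximal ideals\<close>

context ring
begin

lemma ideal_subset_carrier: "ideal I R \<Longrightarrow> I \<subseteq> carrier R"
  by (auto dest: ideal.Icarr)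

text \<open>The sum is the ideal generated by the union.\<close>

lemma ideal_sum_upper:
  assumes "ideal I R" "ideal J R"
  shows "I \<subseteq> I <+>\<^bsub>R\<^esub> J" "J \<subseteq> I <+>\<^bsub>R\<^esub> J"
  using union_genideal[OF assms] genideal_self[of "I \<union> J"] assms[THEN ideal_subset_carrier]
  by simp_all

lemma ideal_sum_least:
  assumes "ideal M R" "I \<subseteq> M" "J \<subseteq> M"
  shows "I <+>\<^bsub>R\<^esub> J \<subseteq> M"
  using assms additive_subgroup.a_closed[OF ideal.axioms(1)[OF assms(1)]]
  unfolding set_add_def' by blast

lemma ideal_sum_absorb:
  assumes "ideal I R" "ideal M R" "I \<subseteq> M"
  shows "I <+>\<^bsub>R\<^esub> M = M"
  using ideal_sum_upper(2)[OF assms(1,2)] ideal_sum_least[OF assms(2,3)] by blast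

lemma ideal_sum_commute:
  assumes "ideal I R" "ideal J R"
  shows "I <+>\<^bsub>R\<^esub> J = J <+>\<^bsub>R\<^esub> I"
  using assms by (intro set_add_comm) (auto dest: ideal.Icarr)

lemma ideal_sum_eq_carrier_mono:
  assumes "I <+>\<^bsub>R\<^esub> J = carrier R" "J \<subseteq> K" "ideal I R" "ideal K R"
  shows "I <+>\<^bsub>R\<^esub> K = carrier R"
proof
  show "I <+>\<^bsub>R\<^esub> K \<subseteq> carrier R"
    by (rule ideal_subset_carrier[OF add_ideals[OF assms(3,4)]])
  show "carrier R \<subseteq> I <+>\<^bsub>R\<^esub> K"
    using assms(1,2) unfolding set_add_def' by blast
qed

text \<open>For \<open>I\<close> inside \<open>M\<close> the modular law gives I + (M \<inter> N) =
  M \<inter> (I + N), and here I + N is the whole ring.\<close>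

lemma ideal_sum_inter_comaximal:
  assumes I: "ideal I R" and M: "ideal M R" and N: "ideal N R"
    and sub: "I \<subseteq> M" and comax: "I <+>\<^bsub>R\<^esub> N = carrier R"
  shows "I <+>\<^bsub>R\<^esub> (M \<inter> N) = M"
proof
  interpret M: ideal M R by fact
  show "I <+>\<^bsub>R\<^esub> (M \<inter> N) \<subseteq> M"
    using ideal_sum_least[OF M sub] by blast
  show "M \<subseteq> I <+>\<^bsub>R\<^esub> (M \<inter> N)"
  proof
    fix m assume m: "m \<in> M"
    then obtain i n where i: "i \<in> I" and n: "n \<in> N" and eq: "m = i \<oplus> n"
      using comax ideal_subset_carrier[OF M] unfolding set_add_def' by blast
    have carr: "i \<in> carrier R" "n \<in> carrier R"
      using i n ideal.Icarr[OF I] ideal.Icarr[OF N] by blast+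
    \<comment> \<open>Solving for \<open>n\<close> places it in \<open>M\<close>, which contains
      both \<open>m\<close> and \<open>i\<close>.\<close>
    have "n = \<ominus> i \<oplus> m"
      using carr eq r_neg1 by simp
    then have "n \<in> M"
      using i m sub M.a_closed M.a_inv_closed by blast
    then show "m \<in> I <+>\<^bsub>R\<^esub> (M \<inter> N)"
      using i n eq unfolding set_add_def' by blast
  qed
qed

section \<open>Existence and comaximality of maximal ideals\<close>

text \<open>Zorn's lemma applied to the proper ideals that contain \<open>I\<close>.\<close>

lemma exists_maximalideal:
  assumes I: "ideal I R" "I \<noteq> carrier R"
  obtains M where "maximalideal M R" "I \<subseteq> M"
proof -
  let ?A = "{J. ideal J R \<and> J \<noteq> carrier R \<and> I \<subseteq> J}"
  have "\<exists>M\<in>?A. \<forall>X\<in>?A. M \<subseteq> X \<longrightarrow> X = M"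
  proof (rule subset_Zorn_nonempty)
    fix C assume C: "C \<noteq> {}" "subset.chain ?A C"
    then have sub: "C \<subseteq> ?A" and "subset.chain {J. ideal J R} C"
      by (simp_all add: pred_on.chain_def subset_eq)
    then have "ideal (\<Union>C) R"
      using chain_Union_is_ideal[of C] C(1) by simp
    \<comment> \<open>An ideal is proper exactly when it omits 1, and this property passes to unions
      of chains.\<close>
    moreover have "\<one> \<notin> J" if "J \<in> C" for J
      using sub that ideal.one_imp_carrier[of J R] by auto
    then have "\<Union>C \<noteq> carrier R" using one_closed by blast
    moreover have "I \<subseteq> \<Union>C" using C(1) sub by blast
    ultimately show "\<Union>C \<in> ?A" by simp
  qed (use I in blast)
  then obtain M where M: "ideal M R" "M \<noteq> carrier R" "I \<subseteq> M"
    and max: "\<forall>X\<in>?A. M \<subseteq> X \<longrightarrow> X = M"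
    by blast
  have "maximalideal M R"
  proof (rule maximalidealI[OF M(1)])
    show "carrier R \<noteq> M" using M(2) by simp
    fix J assume "ideal J R" "M \<subseteq> J" "J \<subseteq> carrier R"
    then show "J = M \<or> J = carrier R" using max M(3) by blast
  qed
  then show ?thesis using that M(3) by blast
qed

lemma maximalideal_eqI:
  assumes "maximalideal M R" "maximalideal N R" "M \<subseteq> N"
  shows "M = N"
proof -
  have "ideal N R" using assms(2) maximalideal.axioms(1) by blast
  then have "N = M \<or> N = carrier R"
    using maximalideal.I_maximal[OF assms(1)] assms(3) ideal_subset_carrier by blast
  then show ?thesis using maximalideal.I_notcarr[OF assms(2)] by blast
qed

text \<open>The sum contains \<open>M\<close> strictly, because \<open>N\<close> inside
  \<open>M\<close> would force equality; maximality of \<open>M\<close> leaves only the whole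
  ring.\<close>

lemma maximalideals_comaximal:
  assumes "maximalideal M R" "maximalideal N R" "M \<noteq> N"
  shows "M <+>\<^bsub>R\<^esub> N = carrier R"
proof -
  have id: "ideal M R" "ideal N R"
    using assms maximalideal.axioms(1) by blast+
  have "\<not> N \<subseteq> M"
    using maximalideal_eqI assms by blast
  then have "M <+>\<^bsub>R\<^esub> N \<noteq> M"
    using ideal_sum_upper(2)[OF id] by blast
  moreover have "M <+>\<^bsub>R\<^esub> N = M \<or> M <+>\<^bsub>R\<^esub> N = carrier R"
    using maximalideal.I_maximal[OF assms(1) add_ideals[OF id] ideal_sum_upper(1)[OF id]]
      ideal_subset_carrier[OF add_ideals[OF id]] by blast
  ultimately show ?thesis by blast
qed

end

section \<open>Product decompositions of the ring\<close>

text \<open>By the Chinese remainder theorem the canonical map to the product of the two residue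
  fields is onto; its kernel is M \<inter> N, hence zero.\<close>

lemma (in cring) comaximal_zero_inter_imp_product_of_fields:
  assumes M: "maximalideal M R" and N: "maximalideal N R"
    and "M \<noteq> N" and zero: "M \<inter> N = {\<zero>}"
  shows "R \<simeq> RDirProd (R Quot M) (R Quot N)" "field (R Quot M)" "field (R Quot N)"
proof -
  have id: "ideal M R" "ideal N R"
    using M N maximalideal.axioms(1) by blast+
  note comax = maximalideals_comaximal[OF assms(1-3)]
  interpret h: ring_hom_ring R "RDirProd (R Quot M) (R Quot N)" "canonical_proj M N"
    by (rule canonical_proj_ring_hom[OF id])
  have "inj_on (canonical_proj M N) (carrier R)"
    using h.trivial_ker_imp_inj canonical_proj_ker[OF id] zero by simp
  then have "canonical_proj M N \<in> ring_iso R (RDirProd (R Quot M) (R Quot N))"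
    using canonical_proj_is_hom[OF id] canonical_proj_is_surj[OF id comax]
    unfolding ring_iso_def bij_betw_def by blast
  then show "R \<simeq> RDirProd (R Quot M) (R Quot N)"
    unfolding is_ring_iso_def by blast
  show "field (R Quot M)" "field (R Quot N)"
    using M N maximalideal.quotient_is_field is_cring by blast+
qed

text \<open>If 1 = 0, every ideal contains 1 and is the whole ring, so none is maximal.\<close>

lemma local_cring_one_not_zero:
  assumes "local_cring S"
  shows "\<one>\<^bsub>S\<^esub> \<noteq> \<zero>\<^bsub>S\<^esub>"
proof
  interpret local_cring S by fact
  assume "\<one>\<^bsub>S\<^esub> = \<zero>\<^bsub>S\<^esub>"
  moreover obtain M where "maximalideal M S" using unique_maximal by blast
  ultimately show False
    using ideal.one_imp_carrier maximalideal.axioms(1) maximalideal.I_notcarr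
      additive_subgroup.zero_closed ideal.axioms(1) by metis
qed

text \<open>If \<open>R\<close> were trivial, the product would have a single element, so the tuple
  of ones would equal the tuple of zeros and the first local factor would be trivial. The result
  makes the zero ideal proper, as the existence of a maximal ideal requires.\<close>

lemma one_not_zero_if_iso_local_product:
  assumes "cring R" "R \<simeq> RDirProd_list Rs" "Rs \<noteq> []"
    and "\<And>i. i < length Rs \<Longrightarrow> local_cring (Rs ! i)"
  shows "\<one>\<^bsub>R\<^esub> \<noteq> \<zero>\<^bsub>R\<^esub>"
proof
  interpret cring R by fact
  assume "\<one>\<^bsub>R\<^esub> = \<zero>\<^bsub>R\<^esub>"
  then have "carrier R = {\<zero>\<^bsub>R\<^esub>}" using one_zeroD by simp
  moreover obtain h where "h \<in> ring_iso R (RDirProd_list Rs)"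
    using assms(2) unfolding is_ring_iso_def by blast
  ultimately have single: "carrier (RDirProd_list Rs) = {h \<zero>\<^bsub>R\<^esub>}"
    using ring_iso_memE(5) by (fastforce simp: bij_betw_def)
  have rings: "ring (Rs ! i)" if "i < length Rs" for i
    using assms(4)[OF that] by (simp add: local_cring_def cring_def)
  have "map one Rs \<in> carrier (RDirProd_list Rs)" "map zero Rs \<in> carrier (RDirProd_list Rs)"
    using rings by (auto intro!: RDirProd_list_carrier_memI simp: ring.ring_simprules(2,6))
  then have "map one Rs = map zero Rs" using single by simp
  then have "\<one>\<^bsub>Rs ! 0\<^esub> = \<zero>\<^bsub>Rs ! 0\<^esub>"
    using assms(3) by (metis length_greater_0_conv nth_map)
  then show False
    using local_cring_one_not_zero assms(3,4) by (metis length_greater_0_conv)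
qed

section \<open>The prime ideal sum graph\<close>

lemma PIS_verts_iff:
  "I \<in> pverts (PIS R) \<longleftrightarrow> ideal I R \<and> I \<noteq> {\<zero>\<^bsub>R\<^esub>} \<and> I \<noteq> carrier R"
  by (simp add: PIS_def Let_def)

lemma PIS_arcs_iff:
  "(I, J) \<in> parcs (PIS R) \<longleftrightarrow>
    I \<in> pverts (PIS R) \<and> J \<in> pverts (PIS R) \<and> I \<noteq> J \<and> primeideal (I <+>\<^bsub>R\<^esub> J) R"
  by (simp add: PIS_def Let_def)

context cring
begin

lemma PIS_adjacent_or_common_neighbour:
  assumes no_fields: "\<not> (\<exists>(K :: 'a ring) (L :: 'a ring). field K \<and> field L \<and> R \<simeq> RDirProd K L)"
    and I: "I \<in> pverts (PIS R)" and J: "J \<in> pverts (PIS R)" and "I \<noteq> J"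
  shows "(I, J) \<in> parcs (PIS R) \<or> (\<exists>K. (I, K) \<in> parcs (PIS R) \<and> (K, J) \<in> parcs (PIS R))"
proof -
  have id: "ideal I R" "ideal J R" and ne: "I \<noteq> {\<zero>}" "J \<noteq> {\<zero>}" "I \<noteq> carrier R" "J \<noteq> carrier R"
    using I J by (simp_all add: PIS_verts_iff)
  show ?thesis
  proof (cases "I <+>\<^bsub>R\<^esub> J = carrier R")
    case False
    obtain M where M: "maximalideal M R" and "I <+>\<^bsub>R\<^esub> J \<subseteq> M"
      using exists_maximalideal[OF add_ideals[OF id] False] by blast
    then have sub: "I \<subseteq> M" "J \<subseteq> M"
      using ideal_sum_upper[OF id] by blast+
    have idM: "ideal M R" using M maximalideal.axioms(1) by blast
    have "M \<noteq> {\<zero>}"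
      using sub(1) ne(1) additive_subgroup.zero_closed[OF ideal.axioms(1)[OF id(1)]] by blast
    then have "M \<in> pverts (PIS R)"
      using idM maximalideal.I_notcarr[OF M] by (auto simp: PIS_verts_iff)
    \<comment> \<open>Arcs are ordered pairs, so the arc from \<open>M\<close> to \<open>J\<close>
      needs the sum in that order. If \<open>M\<close> is \<open>I\<close> or \<open>J\<close>,
      these equations make \<open>I\<close> and \<open>J\<close> themselves adjacent.\<close>
    moreover have "I <+>\<^bsub>R\<^esub> M = M" "J <+>\<^bsub>R\<^esub> M = M" "M <+>\<^bsub>R\<^esub> J = M"
      using ideal_sum_absorb ideal_sum_commute id idM sub by metis+
    ultimately show ?thesis
      using maximalideal_prime[OF M] I J \<open>I \<noteq> J\<close> by (auto simp: PIS_arcs_iff)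
  next
    case True
    obtain M where M: "maximalideal M R" and IM: "I \<subseteq> M"
      using exists_maximalideal[OF id(1) ne(3)] by blast
    obtain N where N: "maximalideal N R" and JN: "J \<subseteq> N"
      using exists_maximalideal[OF id(2) ne(4)] by blast
    have idMN: "ideal M R" "ideal N R"
      using M N maximalideal.axioms(1) by blast+
    \<comment> \<open>This fact separates \<open>M\<close> from \<open>N\<close> here, and
      \<open>?K\<close> from both \<open>I\<close> and \<open>J\<close> below.\<close>
    have not_proper: "\<not> (I \<subseteq> P \<and> J \<subseteq> P)" if "maximalideal P R" for P
      using ideal_sum_least[of P I J] True that maximalideal.axioms(1)[OF that]
        maximalideal.I_notcarr[OF that] ideal_subset_carrier by blast
    have "M \<noteq> N" using not_proper M IM JN by blast
    let ?K = "M \<inter> N"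
    have idK: "ideal ?K R" using i_intersect idMN by blast
    \<comment> \<open>The residue fields consist of cosets, so
      \<open>product_of_two_fields_any_type\<close> is what moves them to the element type of
      \<open>no_fields\<close>.\<close>
    have "?K \<noteq> {\<zero>}"
      using comaximal_zero_inter_imp_product_of_fields[OF M N \<open>M \<noteq> N\<close>]
        product_of_two_fields_any_type[OF ring_axioms] no_fields by blast
    moreover have "?K \<noteq> carrier R"
      using maximalideal.I_notcarr[OF M] ideal_subset_carrier[OF idMN(1)] by blast
    ultimately have K: "?K \<in> pverts (PIS R)"
      using idK by (simp add: PIS_verts_iff)
    have "I <+>\<^bsub>R\<^esub> N = carrier R" "J <+>\<^bsub>R\<^esub> M = carrier R"
      using ideal_sum_eq_carrier_mono True IM JN id idMN ideal_sum_commute[OF id] by metis+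
    then have sum: "I <+>\<^bsub>R\<^esub> ?K = M" "J <+>\<^bsub>R\<^esub> ?K = N"
      using ideal_sum_inter_comaximal[OF id(1) idMN IM]
        ideal_sum_inter_comaximal[OF id(2) idMN(2,1) JN] by (simp_all add: Int_commute)
    \<comment> \<open>If \<open>I\<close> were \<open>?K\<close>, then \<open>N\<close> would
      contain both \<open>I\<close> and \<open>J\<close>; if \<open>J\<close> were
      \<open>?K\<close>, then \<open>M\<close> would.\<close>
    have "I \<noteq> ?K" "?K \<noteq> J"
      using not_proper[OF N] not_proper[OF M] IM JN by blast+
    then show ?thesis
      using sum ideal_sum_commute[OF id(2) idK] I J K maximalideal_prime[OF M]
        maximalideal_prime[OF N] by (auto simp: PIS_arcs_iff)
  qed
qed

text \<open>The sum is the whole ring, which is not a prime ideal. This supplies the pair at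
  distance at least two.\<close>

lemma maximalideals_PIS_not_adjacent:
  assumes M: "maximalideal M R" and N: "maximalideal N R" and "M \<noteq> N"
  shows "M \<in> pverts (PIS R)" "N \<in> pverts (PIS R)" "(M, N) \<notin> parcs (PIS R)"
proof -
  have vertex: "P \<in> pverts (PIS R)"
    if P: "maximalideal P R" and Q: "maximalideal Q R" and "P \<noteq> Q" for P Q
  proof -
    have "\<zero> \<in> Q"
      using Q maximalideal.axioms(1) ideal.axioms(1) additive_subgroup.zero_closed by blast
    \<comment> \<open>A zero \<open>P\<close> would lie inside \<open>Q\<close> and hence, by
      maximality, equal it.\<close>
    then have "P \<noteq> {\<zero>}" using maximalideal_eqI[OF P Q] \<open>P \<noteq> Q\<close> by blast
    then show ?thesis
      using maximalideal.axioms(1)[OF P] maximalideal.I_notcarr[OF P] by (auto simp: PIS_verts_iff)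
  qed
  show "M \<in> pverts (PIS R)" "N \<in> pverts (PIS R)" using vertex assms by blast+
  show "(M, N) \<notin> parcs (PIS R)"
    using maximalideals_comaximal[OF assms] primeideal.I_notcarr by (force simp: PIS_arcs_iff)
qed

end

theorem theorem2p6:
  fixes R :: "('a, 'm) ring_scheme"
    and Rs :: "('b, 'n) ring_scheme list"
  assumes "artinian_cring R"
    and "\<not> local_cring R"
    and "length Rs \<ge> 2"
    and "\<And>i. i < length Rs \<Longrightarrow> local_cring (Rs ! i)"
    and "R \<simeq> RDirProd_list Rs"
    and "\<not> (\<exists>(K :: 'a ring) (L :: 'a ring). field K \<and> field L \<and> R \<simeq> RDirProd K L)"
  shows "connected (with_proj (PIS R)) \<and> graph_diameter (with_proj (PIS R)) = 2"
proof -
  interpret R: cring R using assms(1) by (simp add: artinian_cring_def)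
  interpret G: pair_bidirected_digraph "PIS R"
    by (rule PIS_simple_undirected) (rule R.ring_axioms)
  have "\<one>\<^bsub>R\<^esub> \<noteq> \<zero>\<^bsub>R\<^esub>"
    using one_not_zero_if_iso_local_product[OF R.is_cring assms(5) _ assms(4)] assms(3) by fastforce
  then have "{\<zero>\<^bsub>R\<^esub>} \<noteq> carrier R" using R.one_closed by blast
  then obtain M where M: "maximalideal M R"
    using R.exists_maximalideal[OF R.zeroideal] by blast
  \<comment> \<open>A maximal ideal exists but the ring is not local, so uniqueness must
    fail.\<close>
  then obtain N where N: "maximalideal N R" and "M \<noteq> N"
    using assms(2) R.is_cring unfolding local_cring_def local_cring_axioms_def by metis
  note MN = R.maximalideals_PIS_not_adjacent[OF M N \<open>M \<noteq> N\<close>]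
  have "I \<rightarrow>\<^bsub>with_proj (PIS R)\<^esub> J \<or>
      (\<exists>K. I \<rightarrow>\<^bsub>with_proj (PIS R)\<^esub> K \<and> K \<rightarrow>\<^bsub>with_proj (PIS R)\<^esub> J)"
    if "I \<in> pverts (PIS R)" "J \<in> pverts (PIS R)" "I \<noteq> J" for I J
    using R.PIS_adjacent_or_common_neighbour[OF assms(6) that] by (simp add: arcs_ends_def)
  then show ?thesis
    using G.diameter_eq_2I[of M N] MN \<open>M \<noteq> N\<close> by (simp add: arcs_ends_def)
qed

end
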